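(* Let $Q$ be a quantale, let $X$ be a semigroup, $Y$ a set, and let $R\subseteq X\times Y$ be a residuated relation from $X$ to $Y$. Then $Q$ is isomorphic to $\mathsf{M}R$ as a quantale if and only if there exist a sup-dense semigroup homomorphism $f\colon X\to Q$ and an inf-dense map $g\colon Y\to Q$ such that $$xRy\iff f(x)\leq g(y)$$ for all $x\in X$ and $y\in Y$. In particular, every quantale $Q$ is isomorphic, as a quantale, to $\mathsf{M}(Q,Q,\leq)$, i.e. to $\mathsf{M}R$ for the order relation $R={\leq}$ from the semigroup $(Q,* )$ to the set $Q$.
   Context: A quantale is a complete lattice $Q$ with an associative binary operation $*$ preserving arbitrary suprema in each variable (no unit is assumed). Quantale isomorphisms are bijections preserving arbitrary suprema and multiplication. A semigroup homomorphism $X\to Q$ is taken with respect to $*$ on $Q$. For a semigroup $X$ (product written $xx'$) and $A,B\subseteq X$, $A*B=\{ab\mid a\in A,\ b\in B\}$. A relation from a set $X$ to a set $Y$ is a subset $R\subseteq X\times Y$; $xRy$ means $(x,y)\in R$. For $A\subseteq X$ and $B\subseteq Y$ put $R^{\uparrow}(A)=\{y\in Y\mid \forall a\in A,\ aRy\}$ and $R^{\downarrow}(B)=\{x\in X\mid \forall b\in B,\ xRb\}$. Put $\mathsf{M}R=\{A\subseteq X\mid A=R^{\downarrow}R^{\uparrow}(A)\}$, ordered by inclusion. For a semigroup $X$ and a set $Y$, a relation $R\subseteq X\times Y$ is residuated if there exist maps $\swarrow\colon Y\times X\to Y$ and $\searrow\colon X\times Y\to Y$ such that $(xx')Ry\iff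 xR(y\swarrow x')\iff x'R(x\searrow y)$ for all $x,x'\in X$, $y\in Y$. For a residuated relation $R$, $\mathsf{M}R$ is a quantale with multiplication $A\otimes_R B=R^{\downarrow}R^{\uparrow}(A*B)$ and suprema $\bigsqcup_i A_i=R^{\downarrow}R^{\uparrow}(\bigcup_i A_i)$. The order relation of a quantale, from the semigroup $(Q,* )$ to the set $Q$, is residuated. For a complete lattice $Q$, a map $f\colon X\to Q$ is sup-dense if $q=\bigvee\{f(x)\mid x\in X,\ f(x)\leq q\}$ for all $q\in Q$; a map $g\colon Y\to Q$ is inf-dense if $q=\bigwedge\{g(y)\mid y\in Y,\ q\leq g(y)\}$ for all $q\in Q$. *)

theory Defs
  imports "HOL-Algebra.Complete_Lattice" "HOL-Library.FuncSet"
begin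

section \<open>Semigroups on a carrier set\<close>

text \<open>
  A semigroup is a set \<open>X\<close>, possibly empty, with an operation \<open>m\<close> of which only the
  values on \<open>X\<close> matter.
\<close>

definition semigroup_on :: "'x set \<Rightarrow> ('x \<Rightarrow> 'x \<Rightarrow> 'x) \<Rightarrow> bool" where
  "semigroup_on X m \<longleftrightarrow>
     (\<forall>x\<in>X. \<forall>y\<in>X. m x y \<in> X) \<and>
     (\<forall>x\<in>X. \<forall>y\<in>X. \<forall>z\<in>X. m (m x y) z = m x (m y z))"

definition semigroup_hom_on ::
    "'x set \<Rightarrow> ('x \<Rightarrow> 'x \<Rightarrow> 'x) \<Rightarrow> 'z set \<Rightarrow> ('z \<Rightarrow> 'z \<Rightarrow> 'z) \<Rightarrow> ('x \<Rightarrow> 'z) \<Rightarrow> bool" where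
  "semigroup_hom_on X m Z n f \<longleftrightarrow>
     f \<in> X \<rightarrow> Z \<and> (\<forall>x\<in>X. \<forall>y\<in>X. f (m x y) = n (f x) (f y))"

definition set_product :: "('x \<Rightarrow> 'x \<Rightarrow> 'x) \<Rightarrow> 'x set \<Rightarrow> 'x set \<Rightarrow> 'x set" where
  "set_product m A B = {m a b | a b. a \<in> A \<and> b \<in> B}"


section \<open>Quantales\<close>

record 'a quantale = "'a gorder" +
  qmult :: "'a \<Rightarrow> 'a \<Rightarrow> 'a" (infixl \<open>\<star>\<index>\<close> 70)

locale quantale = complete_lattice Q for Q (structure) +
  assumes qmult_semigroup: "semigroup_on (carrier Q) (\<star>)"
    and sup_qmult:
      "\<lbrakk>A \<subseteq> carrier Q; b \<in> carrier Q\<rbrakk> \<Longrightarrow> (\<Squnion>A) \<star> b = \<Squnion>((\<lambda>a. a \<star> b) ` A)"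
    and qmult_sup:
      "\<lbrakk>a \<in> carrier Q; B \<subseteq> carrier Q\<rbrakk> \<Longrightarrow> a \<star> (\<Squnion>B) = \<Squnion>((\<lambda>b. a \<star> b) ` B)"

definition quantale_iso ::
    "('a, 'c) quantale_scheme \<Rightarrow> ('b, 'd) quantale_scheme \<Rightarrow> ('a \<Rightarrow> 'b) \<Rightarrow> bool" where
  "quantale_iso Q P h \<longleftrightarrow>
     bij_betw h (carrier Q) (carrier P) \<and>
     sup_pres Q P h \<and>
     (\<forall>a\<in>carrier Q. \<forall>b\<in>carrier Q. h (a \<star>\<^bsub>Q\<^esub> b) = h a \<star>\<^bsub>P\<^esub> h b)"

definition quantale_isomorphic ::
    "('a, 'c) quantale_scheme \<Rightarrow> ('b, 'd) quantale_scheme \<Rightarrow> bool" where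
  "quantale_isomorphic Q P \<longleftrightarrow> (\<exists>h. quantale_iso Q P h)"

definition sup_dense :: "'x set \<Rightarrow> ('a, 'c) gorder_scheme \<Rightarrow> ('x \<Rightarrow> 'a) \<Rightarrow> bool" where
  "sup_dense X Q f \<longleftrightarrow>
     f \<in> X \<rightarrow> carrier Q \<and>
     (\<forall>q\<in>carrier Q. q = \<Squnion>\<^bsub>Q\<^esub>{f x | x. x \<in> X \<and> f x \<sqsubseteq>\<^bsub>Q\<^esub> q})"

definition inf_dense :: "'y set \<Rightarrow> ('a, 'c) gorder_scheme \<Rightarrow> ('y \<Rightarrow> 'a) \<Rightarrow> bool" where
  "inf_dense Y Q g \<longleftrightarrow>
     g \<in> Y \<rightarrow> carrier Q \<and>
     (\<forall>q\<in>carrier Q. q = \<Sqinter>\<^bsub>Q\<^esub>{g y | y. y \<in> Y \<and> q \<sqsubseteq>\<^bsub>Q\<^esub> g y})"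


section \<open>Residuated relations and their quantales\<close>

definition polar_up :: "'y set \<Rightarrow> ('x \<times> 'y) set \<Rightarrow> 'x set \<Rightarrow> 'y set" where
  "polar_up Y R A = {y \<in> Y. \<forall>a\<in>A. (a, y) \<in> R}"

definition polar_down :: "'x set \<Rightarrow> ('x \<times> 'y) set \<Rightarrow> 'y set \<Rightarrow> 'x set" where
  "polar_down X R B = {x \<in> X. \<forall>b\<in>B. (x, b) \<in> R}"

definition residuated_relation ::
    "'x set \<Rightarrow> ('x \<Rightarrow> 'x \<Rightarrow> 'x) \<Rightarrow> 'y set \<Rightarrow> ('x \<times> 'y) set \<Rightarrow> bool" where
  "residuated_relation X m Y R \<longleftrightarrow>
     R \<subseteq> X \<times> Y \<and>
     (\<exists>sw \<in> Y \<rightarrow> X \<rightarrow> Y. \<exists>se \<in> X \<rightarrow> Y \<rightarrow> Y.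
        \<forall>x\<in>X. \<forall>x'\<in>X. \<forall>y\<in>Y.
          ((m x x', y) \<in> R \<longleftrightarrow> (x, sw y x') \<in> R) \<and>
          ((m x x', y) \<in> R \<longleftrightarrow> (x', se x y) \<in> R))"

text \<open>
  Only the order and the multiplication of \<open>\<M>R\<close> are given; suprema are those of the
  inclusion order, as for any \<^typ>\<open>'a gorder\<close>, and \<open>M_quantale_sup\<close> below identifies them with
  the closures of unions.
\<close>

definition M_quantale ::
    "'x set \<Rightarrow> ('x \<Rightarrow> 'x \<Rightarrow> 'x) \<Rightarrow> 'y set \<Rightarrow> ('x \<times> 'y) set \<Rightarrow> 'x set quantale" where
  "M_quantale X m Y R =
     \<lparr>carrier = {A. A \<subseteq> X \<and> A = polar_down X R (polar_up Y R A)},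
      eq = (=),
      le = (\<subseteq>),
      qmult = (\<lambda>A B. polar_down X R (polar_up Y R (set_product m A B)))\<rparr>"

definition order_relation :: "('a, 'c) gorder_scheme \<Rightarrow> ('a \<times> 'a) set" where
  "order_relation Q = {(p, q). p \<in> carrier Q \<and> q \<in> carrier Q \<and> p \<sqsubseteq>\<^bsub>Q\<^esub> q}"

lemma residuated_order_relation:
  assumes "quantale Q"
  shows "residuated_relation (carrier Q) (qmult Q) (carrier Q) (order_relation Q)"
proof -
  interpret quantale Q by fact
  have cl: "a \<star>\<^bsub>Q\<^esub> b \<in> carrier Q" if "a \<in> carrier Q" "b \<in> carrier Q" for a b
    using qmult_semigroup that by (auto simp: semigroup_on_def)
  have mono_l: "a \<star>\<^bsub>Q\<^esub> c \<sqsubseteq>\<^bsub>Q\<^esub> b \<star>\<^bsub>Q\<^esub> c"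
    if "a \<in> carrier Q" "b \<in> carrier Q" "c \<in> carrier Q" "a \<sqsubseteq>\<^bsub>Q\<^esub> b" for a b c
  proof -
    have "\<Squnion>\<^bsub>Q\<^esub>{a, b} = b"
      using that by (intro le_antisym) (auto intro: sup_least sup_upper)
    then have "b \<star>\<^bsub>Q\<^esub> c = \<Squnion>\<^bsub>Q\<^esub>((\<lambda>a. a \<star>\<^bsub>Q\<^esub> c) ` {a, b})"
      using sup_qmult[of "{a, b}" c] that by simp
    then show ?thesis
      using that cl sup_upper[of "{a \<star>\<^bsub>Q\<^esub> c, b \<star>\<^bsub>Q\<^esub> c}" "a \<star>\<^bsub>Q\<^esub> c"] by simp
  qed
  have mono_r: "c \<star>\<^bsub>Q\<^esub> a \<sqsubseteq>\<^bsub>Q\<^esub> c \<star>\<^bsub>Q\<^esub> b"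
    if "a \<in> carrier Q" "b \<in> carrier Q" "c \<in> carrier Q" "a \<sqsubseteq>\<^bsub>Q\<^esub> b" for a b c
  proof -
    have "\<Squnion>\<^bsub>Q\<^esub>{a, b} = b"
      using that by (intro le_antisym) (auto intro: sup_least sup_upper)
    then have "c \<star>\<^bsub>Q\<^esub> b = \<Squnion>\<^bsub>Q\<^esub>((\<lambda>a. c \<star>\<^bsub>Q\<^esub> a) ` {a, b})"
      using qmult_sup[of c "{a, b}"] that by simp
    then show ?thesis
      using that cl sup_upper[of "{c \<star>\<^bsub>Q\<^esub> a, c \<star>\<^bsub>Q\<^esub> b}" "c \<star>\<^bsub>Q\<^esub> a"] by simp
  qed
  let ?sw = "\<lambda>y x'. \<Squnion>\<^bsub>Q\<^esub>{z \<in> carrier Q. z \<star>\<^bsub>Q\<^esub> x' \<sqsubseteq>\<^bsub>Q\<^esub> y}"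
  let ?se = "\<lambda>x y. \<Squnion>\<^bsub>Q\<^esub>{z \<in> carrier Q. x \<star>\<^bsub>Q\<^esub> z \<sqsubseteq>\<^bsub>Q\<^esub> y}"
  have sw: "?sw y x \<in> carrier Q" and se: "?se x y \<in> carrier Q" for x y
    by (auto intro: sup_closed)
  have "(x \<star>\<^bsub>Q\<^esub> x' \<sqsubseteq>\<^bsub>Q\<^esub> y \<longleftrightarrow> x \<sqsubseteq>\<^bsub>Q\<^esub> ?sw y x') \<and> (x \<star>\<^bsub>Q\<^esub> x' \<sqsubseteq>\<^bsub>Q\<^esub> y \<longleftrightarrow> x' \<sqsubseteq>\<^bsub>Q\<^esub> ?se x y)"
    if "x \<in> carrier Q" "x' \<in> carrier Q" "y \<in> carrier Q" for x x' y
  proof -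
    have "?sw y x' \<star>\<^bsub>Q\<^esub> x' \<sqsubseteq>\<^bsub>Q\<^esub> y"
      using that cl by (subst sup_qmult) (auto intro!: sup_least)
    moreover have "x \<star>\<^bsub>Q\<^esub> ?se x y \<sqsubseteq>\<^bsub>Q\<^esub> y"
      using that cl by (subst qmult_sup) (auto intro!: sup_least)
    moreover have "x \<star>\<^bsub>Q\<^esub> x' \<sqsubseteq>\<^bsub>Q\<^esub> ?sw y x' \<star>\<^bsub>Q\<^esub> x'" if "x \<sqsubseteq>\<^bsub>Q\<^esub> ?sw y x'"
      using mono_l[OF \<open>x \<in> carrier Q\<close> sw \<open>x' \<in> carrier Q\<close> that] .
    moreover have "x \<star>\<^bsub>Q\<^esub> x' \<sqsubseteq>\<^bsub>Q\<^esub> x \<star>\<^bsub>Q\<^esub> ?se x y" if "x' \<sqsubseteq>\<^bsub>Q\<^esub> ?se x y"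
      using mono_r[OF \<open>x' \<in> carrier Q\<close> se \<open>x \<in> carrier Q\<close> that] .
    moreover have "x \<sqsubseteq>\<^bsub>Q\<^esub> ?sw y x'" "x' \<sqsubseteq>\<^bsub>Q\<^esub> ?se x y" if "x \<star>\<^bsub>Q\<^esub> x' \<sqsubseteq>\<^bsub>Q\<^esub> y"
      using that \<open>x \<in> carrier Q\<close> \<open>x' \<in> carrier Q\<close> by (auto intro!: sup_upper)
    ultimately show ?thesis
      using le_trans cl[OF that(1,2)] cl[OF sw that(2)] cl[OF that(1) se] that(3) by meson
  qed
  note adjoint = this
  show ?thesis
    unfolding residuated_relation_def order_relation_def
    by (rule conjI, blast, rule bexI[of _ ?sw], rule bexI[of _ ?se])
      (use sw se in \<open>auto simp: adjoint[THEN conjunct1, symmetric] adjoint[THEN conjunct2, symmetric] cl\<close>)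
qed

lemma M_quantale_facts:
  assumes "semigroup_on X m" "residuated_relation X m Y R"
  shows quantale_M_quantale: "quantale (M_quantale X m Y R)"
    and M_quantale_sup: "\<A> \<subseteq> carrier (M_quantale X m Y R) \<Longrightarrow>
      \<Squnion>\<^bsub>M_quantale X m Y R\<^esub>\<A> = polar_down X R (polar_up Y R (\<Union>\<A>))"
proof -
  let ?M = "M_quantale X m Y R"
  define cl where "cl A = polar_down X R (polar_up Y R A)" for A
  note defs = cl_def polar_down_def polar_up_def
  have carr: "A \<in> carrier ?M \<longleftrightarrow> A \<subseteq> X \<and> cl A = A" for A
    unfolding M_quantale_def cl_def by auto
  have le: "le ?M = (\<subseteq>)" and eq: "eq ?M = (=)"
    and mu: "qmult ?M A B = cl (set_product m A B)" for A B
    unfolding M_quantale_def cl_def by simp_all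
  have clX: "cl A \<subseteq> X" for A unfolding defs by auto
  have ext: "A \<subseteq> X \<Longrightarrow> A \<subseteq> cl A" for A unfolding defs by auto
  have mono: "A \<subseteq> B \<Longrightarrow> cl A \<subseteq> cl B" for A B unfolding defs by auto
  have idem: "cl (cl A) = cl A" for A unfolding defs by blast
  have adj: "cl A \<subseteq> C \<longleftrightarrow> A \<subseteq> C" if "A \<subseteq> X" "C \<in> carrier ?M" for A C
    using ext[OF that(1)] mono[of A C] that(2) carr[of C] by auto
  have cl_in: "cl A \<in> carrier ?M" for A by (simp add: carr clX idem)
  have m_in: "m x y \<in> X" if "x \<in> X" "y \<in> X" for x y
    using assms(1) that by (auto simp: semigroup_on_def)
  have sp_in: "set_product m A B \<subseteq> X" if "A \<subseteq> X" "B \<subseteq> X" for A B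
    using that m_in by (auto simp: set_product_def)
  have sp_mono: "set_product m A B \<subseteq> set_product m A' B'" if "A \<subseteq> A'" "B \<subseteq> B'" for A B A' B'
    using that by (auto simp: set_product_def)
  obtain sw se where sw: "sw \<in> Y \<rightarrow> X \<rightarrow> Y" and se: "se \<in> X \<rightarrow> Y \<rightarrow> Y"
    and res: "\<And>x x' y. x \<in> X \<Longrightarrow> x' \<in> X \<Longrightarrow> y \<in> Y \<Longrightarrow>
          ((m x x', y) \<in> R \<longleftrightarrow> (x, sw y x') \<in> R) \<and>
          ((m x x', y) \<in> R \<longleftrightarrow> (x', se x y) \<in> R)"
    using assms(2) unfolding residuated_relation_def by metis
  have clR: "(x, y) \<in> R" if "x \<in> cl A" "y \<in> Y" "\<And>a. a \<in> A \<Longrightarrow> (a, y) \<in> R" for x y A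
    using that unfolding defs by auto
  have nuc_l: "set_product m (cl A) B \<subseteq> cl (set_product m A B)" if "A \<subseteq> X" "B \<subseteq> X" for A B
  proof
    fix c assume "c \<in> set_product m (cl A) B"
    then obtain a b where ab: "a \<in> cl A" "b \<in> B" "c = m a b" by (auto simp: set_product_def)
    have "(c, y) \<in> R" if y: "y \<in> polar_up Y R (set_product m A B)" for y
    proof -
      have Y: "y \<in> Y" "sw y b \<in> Y" using y sw ab \<open>B \<subseteq> X\<close> by (auto simp: polar_up_def)
      have "(a', sw y b) \<in> R" if "a' \<in> A" for a'
      proof -
        have "(m a' b, y) \<in> R" using y ab that by (auto simp: polar_up_def set_product_def)
        then show ?thesis using res[of a' b y] that ab Y \<open>A \<subseteq> X\<close> \<open>B \<subseteq> X\<close> by auto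
      qed
      then have "(a, sw y b) \<in> R" using clR[OF ab(1) Y(2)] by auto
      then show ?thesis using res[of a b y] ab clX Y \<open>B \<subseteq> X\<close> by auto
    qed
    moreover have "c \<in> X" using ab clX m_in \<open>B \<subseteq> X\<close> by blast
    ultimately show "c \<in> cl (set_product m A B)" by (simp add: cl_def polar_down_def)
  qed
  have nuc_r: "set_product m A (cl B) \<subseteq> cl (set_product m A B)" if "A \<subseteq> X" "B \<subseteq> X" for A B
  proof
    fix c assume "c \<in> set_product m A (cl B)"
    then obtain a b where ab: "a \<in> A" "b \<in> cl B" "c = m a b" by (auto simp: set_product_def)
    have "(c, y) \<in> R" if y: "y \<in> polar_up Y R (set_product m A B)" for y
    proof -
      have Y: "y \<in> Y" "se a y \<in> Y" using y se ab \<open>A \<subseteq> X\<close> by (auto simp: polar_up_def)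
      have "(b', se a y) \<in> R" if "b' \<in> B" for b'
      proof -
        have "(m a b', y) \<in> R" using y ab that by (auto simp: polar_up_def set_product_def)
        then show ?thesis using res[of a b' y] that ab Y \<open>A \<subseteq> X\<close> \<open>B \<subseteq> X\<close> by auto
      qed
      then have "(b, se a y) \<in> R" using clR[OF ab(2) Y(2)] by auto
      then show ?thesis using res[of a b y] ab clX Y \<open>A \<subseteq> X\<close> by auto
    qed
    moreover have "c \<in> X" using ab clX m_in \<open>A \<subseteq> X\<close> by blast
    ultimately show "c \<in> cl (set_product m A B)" by (simp add: cl_def polar_down_def)
  qed
  have cl_l: "cl (set_product m (cl A) B) = cl (set_product m A B)" if "A \<subseteq> X" "B \<subseteq> X" for A B
    using mono[OF nuc_l[OF that]] mono[OF sp_mono[OF ext[OF that(1)] order_refl, of B]] idem by auto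
  have cl_r: "cl (set_product m A (cl B)) = cl (set_product m A B)" if "A \<subseteq> X" "B \<subseteq> X" for A B
    using mono[OF nuc_r[OF that]] mono[OF sp_mono[OF order_refl ext[OF that(2)], of A]] idem by auto
  have cl_U: "cl (\<Union>(cl ` \<B>)) = cl (\<Union>\<B>)" if "\<And>B. B \<in> \<B> \<Longrightarrow> B \<subseteq> X" for \<B>
  proof
    have "cl B \<subseteq> cl (\<Union>\<B>)" if "B \<in> \<B>" for B using that by (intro mono) auto
    then show "cl (\<Union>(cl ` \<B>)) \<subseteq> cl (\<Union>\<B>)" using mono[of "\<Union>(cl ` \<B>)" "cl (\<Union>\<B>)"] idem by auto
    show "cl (\<Union>\<B>) \<subseteq> cl (\<Union>(cl ` \<B>))" using ext that by (intro mono) blast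
  qed
  interpret partial_order ?M
    by unfold_locales (auto simp: le eq)
  have lub: "least ?M (cl (\<Union>\<A>)) (Upper ?M \<A>)" if "\<A> \<subseteq> carrier ?M" for \<A>
  proof -
    have "\<Union>\<A> \<subseteq> X" using that carr by auto
    then show ?thesis
      using that cl_in adj[OF \<open>\<Union>\<A> \<subseteq> X\<close>] ext[OF \<open>\<Union>\<A> \<subseteq> X\<close>]
      by (intro least_UpperI) (auto simp: le Upper_def)
  qed
  have glb: "greatest ?M (X \<inter> \<Inter>\<A>) (Lower ?M \<A>)" if "\<A> \<subseteq> carrier ?M" for \<A>
  proof -
    have "cl (X \<inter> \<Inter>\<A>) \<subseteq> A" if "A \<in> \<A>" for A
      using that \<open>\<A> \<subseteq> carrier ?M\<close> adj[of "X \<inter> \<Inter>\<A>" A] by auto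
    then have "cl (X \<inter> \<Inter>\<A>) = X \<inter> \<Inter>\<A>" using clX ext[of "X \<inter> \<Inter>\<A>"] by auto
    then have "X \<inter> \<Inter>\<A> \<in> carrier ?M" using carr by auto
    then show ?thesis
      using that by (intro greatest_LowerI) (auto simp: le Lower_def carr, use carr in blast)
  qed
  interpret complete_lattice ?M
    by unfold_locales (use lub glb in blast)+
  have sup: "\<Squnion>\<^bsub>?M\<^esub>\<A> = cl (\<Union>\<A>)" if "\<A> \<subseteq> carrier ?M" for \<A>
    using sup_lub[OF that] lub[OF that] weak_least_unique eq by auto
  then show "\<A> \<subseteq> carrier ?M \<Longrightarrow> \<Squnion>\<^bsub>?M\<^esub>\<A> = polar_down X R (polar_up Y R (\<Union>\<A>))"
    unfolding cl_def by simp
  have assoc: "set_product m (set_product m A B) C = set_product m A (set_product m B C)"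
    if "A \<subseteq> X" "B \<subseteq> X" "C \<subseteq> X" for A B C
  proof -
    have "m (m a b) c = m a (m b c)" if "a \<in> A" "b \<in> B" "c \<in> C" for a b c
      using assms(1) that \<open>A \<subseteq> X\<close> \<open>B \<subseteq> X\<close> \<open>C \<subseteq> X\<close>
      by (auto simp: semigroup_on_def subset_iff)
    then show ?thesis unfolding set_product_def by (auto; metis)
  qed
  show "quantale ?M"
  proof unfold_locales
    show "semigroup_on (carrier ?M) (qmult ?M)"
      unfolding semigroup_on_def mu using cl_in carr cl_l cl_r assoc sp_in by auto
  next
    fix \<A> B assume *: "\<A> \<subseteq> carrier ?M" "B \<in> carrier ?M"
    then have X: "\<Union>\<A> \<subseteq> X" "B \<subseteq> X" using carr by auto
    have sp: "set_product m A B \<subseteq> X" if "A \<in> \<A>" for A using that X by (intro sp_in) auto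
    have "\<Squnion>\<^bsub>?M\<^esub>\<A> \<star>\<^bsub>?M\<^esub> B = cl (set_product m (\<Union>\<A>) B)"
      using sup[OF *(1)] cl_l X mu by simp
    also have "set_product m (\<Union>\<A>) B = \<Union>((\<lambda>A. set_product m A B) ` \<A>)"
      by (auto simp: set_product_def)
    also have "cl \<dots> = cl (\<Union>(cl ` (\<lambda>A. set_product m A B) ` \<A>))"
      using sp by (subst cl_U) auto
    also have "\<dots> = \<Squnion>\<^bsub>?M\<^esub>((\<lambda>A. A \<star>\<^bsub>?M\<^esub> B) ` \<A>)"
      using cl_in by (subst sup) (auto simp: mu image_image)
    finally show "\<Squnion>\<^bsub>?M\<^esub>\<A> \<star>\<^bsub>?M\<^esub> B = \<Squnion>\<^bsub>?M\<^esub>((\<lambda>A. A \<star>\<^bsub>?M\<^esub> B) ` \<A>)" .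
  next
    fix A \<B> assume *: "A \<in> carrier ?M" "\<B> \<subseteq> carrier ?M"
    then have X: "\<Union>\<B> \<subseteq> X" "A \<subseteq> X" using carr by auto
    have sp: "set_product m A B \<subseteq> X" if "B \<in> \<B>" for B using that X by (intro sp_in) auto
    have "A \<star>\<^bsub>?M\<^esub> \<Squnion>\<^bsub>?M\<^esub>\<B> = cl (set_product m A (\<Union>\<B>))"
      using sup[OF *(2)] cl_r X mu by simp
    also have "set_product m A (\<Union>\<B>) = \<Union>(set_product m A ` \<B>)"
      by (auto simp: set_product_def)
    also have "cl \<dots> = cl (\<Union>(cl ` set_product m A ` \<B>))"
      using sp by (subst cl_U) auto
    also have "\<dots> = \<Squnion>\<^bsub>?M\<^esub>((\<lambda>B. A \<star>\<^bsub>?M\<^esub> B) ` \<B>)"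
      using cl_in by (subst sup) (auto simp: mu image_image)
    finally show "A \<star>\<^bsub>?M\<^esub> \<Squnion>\<^bsub>?M\<^esub>\<B> = \<Squnion>\<^bsub>?M\<^esub>((\<lambda>B. A \<star>\<^bsub>?M\<^esub> B) ` \<B>)" .
  qed
qed

end

(*
  For a sup-dense f and an inf-dense g representing R, the closure of A is the set of all x with
  f x below the supremum of f ` A; hence q |-> {x. f x <= q} is an isomorphism onto the closed sets.
  Conversely, an isomorphism h onto the closed sets represents R by the elements of Q that h maps
  to the closure of {x} and to the polar of {y}.
*)
theory Submission
  imports Defs
begin

section \<open>Density as separation of elements\<close>

text \<open>The supremum of the values \<open>f x\<close> below \<open>q\<close> always lies below
  \<open>q\<close>, so density amounts to the reverse inequality, which the separation condition
  gives when applied to \<open>q\<close> and that supremum. Conversely, if every value below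
  \<open>p\<close> is below \<open>q\<close>, then so is their supremum \<open>p\<close>. This form
  involves only the order and can be checked without computing suprema.\<close>

lemma (in complete_lattice) sup_dense_iff:
  "sup_dense X L f \<longleftrightarrow> f \<in> X \<rightarrow> carrier L \<and>
    (\<forall>p\<in>carrier L. \<forall>q\<in>carrier L. (\<forall>x\<in>X. f x \<sqsubseteq> p \<longrightarrow> f x \<sqsubseteq> q) \<longrightarrow> p \<sqsubseteq> q)"
  (is "_ \<longleftrightarrow> ?in \<and> ?sep")
proof (cases ?in)
  case True
  have S: "{f x | x. x \<in> X \<and> f x \<sqsubseteq> q} \<subseteq> carrier L" for q using True by auto
  have ub: "\<Squnion>{f x | x. x \<in> X \<and> f x \<sqsubseteq> p} \<sqsubseteq> q"
    if "q \<in> carrier L" "\<forall>x\<in>X. f x \<sqsubseteq> p \<longrightarrow> f x \<sqsubseteq> q" for p q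
    using that S by (intro sup_least) auto
  have "q = \<Squnion>{f x | x. x \<in> X \<and> f x \<sqsubseteq> q}" if ?sep "q \<in> carrier L" for q
  proof (rule le_antisym)
    let ?s = "\<Squnion>{f x | x. x \<in> X \<and> f x \<sqsubseteq> q}"
    show s: "?s \<in> carrier L" using S by (rule sup_closed)
    show "q \<sqsubseteq> ?s" using that s sup_upper[OF S[of q]] by blast
  qed (use ub that in auto)
  moreover have "p \<sqsubseteq> q"
    if "sup_dense X L f" "p \<in> carrier L" "q \<in> carrier L" "\<forall>x\<in>X. f x \<sqsubseteq> p \<longrightarrow> f x \<sqsubseteq> q" for p q
    using that ub[of q p] by (simp add: sup_dense_def)
  ultimately show ?thesis using True unfolding sup_dense_def by blast
qed (simp add: sup_dense_def)

text \<open>The order-reversed argument: the infimum of the values above \<open>q\<close> lies above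
  \<open>q\<close>, and separation supplies the other inequality.\<close>

lemma (in complete_lattice) inf_dense_iff:
  "inf_dense Y L g \<longleftrightarrow> g \<in> Y \<rightarrow> carrier L \<and>
    (\<forall>p\<in>carrier L. \<forall>q\<in>carrier L. (\<forall>y\<in>Y. q \<sqsubseteq> g y \<longrightarrow> p \<sqsubseteq> g y) \<longrightarrow> p \<sqsubseteq> q)"
  (is "_ \<longleftrightarrow> ?in \<and> ?sep")
proof (cases ?in)
  case True
  have S: "{g y | y. y \<in> Y \<and> q \<sqsubseteq> g y} \<subseteq> carrier L" for q using True by auto
  have lb: "p \<sqsubseteq> \<Sqinter>{g y | y. y \<in> Y \<and> q \<sqsubseteq> g y}"
    if "p \<in> carrier L" "\<forall>y\<in>Y. q \<sqsubseteq> g y \<longrightarrow> p \<sqsubseteq> g y" for p q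
    using that S by (intro inf_greatest) auto
  have "q = \<Sqinter>{g y | y. y \<in> Y \<and> q \<sqsubseteq> g y}" if ?sep "q \<in> carrier L" for q
  proof (rule le_antisym)
    let ?s = "\<Sqinter>{g y | y. y \<in> Y \<and> q \<sqsubseteq> g y}"
    show s: "?s \<in> carrier L" using S by (rule inf_closed)
    show "?s \<sqsubseteq> q" using that s inf_lower[OF S[of q]] by blast
  qed (use lb that in auto)
  moreover have "p \<sqsubseteq> q"
    if "inf_dense Y L g" "p \<in> carrier L" "q \<in> carrier L" "\<forall>y\<in>Y. q \<sqsubseteq> g y \<longrightarrow> p \<sqsubseteq> g y" for p q
    using that lb[of p q] by (simp add: inf_dense_def)
  ultimately show ?thesis using True unfolding inf_dense_def by blast
qed (simp add: inf_dense_def)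

section \<open>Suprema, and the order under isomorphisms\<close>

lemma (in complete_lattice) sup_le_iff:
  assumes "A \<subseteq> carrier L" "b \<in> carrier L"
  shows "\<Squnion>A \<sqsubseteq> b \<longleftrightarrow> (\<forall>a\<in>A. a \<sqsubseteq> b)"
  using assms sup_upper sup_least sup_closed by (meson le_trans subsetD)

lemma (in complete_lattice) sup_pair_eq_iff:
  assumes "a \<in> carrier L" "b \<in> carrier L"
  shows "\<Squnion>{a, b} = b \<longleftrightarrow> a \<sqsubseteq> b"
proof
  assume "\<Squnion>{a, b} = b"
  then show "a \<sqsubseteq> b" using sup_upper[of "{a, b}" a] assms by auto
next
  assume "a \<sqsubseteq> b"
  then show "\<Squnion>{a, b} = b"
    using assms by (intro le_antisym) (auto intro: sup_least sup_upper)
qed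

text \<open>An isomorphism is only required to preserve suprema, but the order is encoded in binary
  ones: \<open>a\<close> lies below \<open>b\<close> exactly when their supremum is
  \<open>b\<close>, and an injective map preserving suprema both preserves and reflects this
  equation.\<close>

lemma quantale_iso_le_iff:
  assumes "quantale_iso Q P h" "a \<in> carrier Q" "b \<in> carrier Q"
  shows "a \<sqsubseteq>\<^bsub>Q\<^esub> b \<longleftrightarrow> h a \<sqsubseteq>\<^bsub>P\<^esub> h b"
proof -
  have bij: "bij_betw h (carrier Q) (carrier P)" and sp: "sup_pres Q P h"
    using assms(1) by (auto simp: quantale_iso_def)
  interpret Q: complete_lattice Q using sp by (simp add: sup_pres_def)
  interpret P: complete_lattice P using sp by (simp add: sup_pres_def)
  have "h a \<in> carrier P" "h b \<in> carrier P" using bij assms by (auto simp: bij_betw_def)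
  moreover have "h (\<Squnion>\<^bsub>Q\<^esub>{a, b}) = \<Squnion>\<^bsub>P\<^esub>{h a, h b}"
    using sp assms by (simp add: sup_pres_def)
  moreover have "h (\<Squnion>\<^bsub>Q\<^esub>{a, b}) = h b \<longleftrightarrow> \<Squnion>\<^bsub>Q\<^esub>{a, b} = b"
    using bij assms by (intro inj_on_eq_iff) (auto simp: bij_betw_def intro: Q.sup_closed)
  ultimately show ?thesis
    using assms by (simp flip: Q.sup_pair_eq_iff P.sup_pair_eq_iff)
qed

section \<open>Products of closures and of suprema\<close>

text \<open>Both product sets have the same upper polar: residuation isolates one factor of
  \<open>m a b\<close> at a time, and a relation to a fixed element of \<open>Y\<close> extends from
  a set to its closure. Applied to singletons, this makes the closure of \<open>{x}\<close>
  multiplicative in \<open>x\<close>.\<close>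

lemma polar_down_up_set_product:
  assumes X: "semigroup_on X m" and R: "residuated_relation X m Y R"
    and AB: "A \<subseteq> X" "B \<subseteq> X"
  shows "polar_down X R (polar_up Y R (set_product m
           (polar_down X R (polar_up Y R A)) (polar_down X R (polar_up Y R B)))) =
         polar_down X R (polar_up Y R (set_product m A B))"
proof -
  let ?cl = "\<lambda>A. polar_down X R (polar_up Y R A)"
  obtain sw se where sw: "sw \<in> Y \<rightarrow> X \<rightarrow> Y" and se: "se \<in> X \<rightarrow> Y \<rightarrow> Y"
    and res: "\<And>x x' y. x \<in> X \<Longrightarrow> x' \<in> X \<Longrightarrow> y \<in> Y \<Longrightarrow>
          ((m x x', y) \<in> R \<longleftrightarrow> (x, sw y x') \<in> R) \<and>
          ((m x x', y) \<in> R \<longleftrightarrow> (x', se x y) \<in> R)"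
    using R unfolding residuated_relation_def by metis
  have clR: "(x, y) \<in> R" if "x \<in> ?cl A" "y \<in> Y" "\<And>a. a \<in> A \<Longrightarrow> (a, y) \<in> R" for x y A
    using that by (auto simp: polar_down_def polar_up_def)
  have clX: "x \<in> X" if "x \<in> ?cl A" for x A using that by (simp add: polar_down_def)
  have "(m a b, y) \<in> R"
    if y: "y \<in> Y" "\<And>a b. a \<in> A \<Longrightarrow> b \<in> B \<Longrightarrow> (m a b, y) \<in> R"
      and ab: "a \<in> ?cl A" "b \<in> ?cl B" for a b y
  proof -
    \<comment> \<open>The left factor is enlarged first, with the right one still in
      \<open>B\<close>: moving \<open>b'\<close> across leaves a condition on \<open>a\<close>
      against the single element \<open>sw y b'\<close>.\<close>
    have "(m a b', y) \<in> R" if "b' \<in> B" for b'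
    proof -
      have b': "b' \<in> X" "sw y b' \<in> Y" using that AB sw y by auto
      then have "(a, sw y b') \<in> R" using ab y AB res that by (intro clR[of a A]) blast+
      then show ?thesis using res clX[OF ab(1)] b' y by blast
    qed
    \<comment> \<open>With \<open>a\<close> now anywhere in the closure of \<open>A\<close>, moving
      it across to \<open>se a y\<close> lets the right factor range over the closure of
      \<open>B\<close>.\<close>
    moreover have "se a y \<in> Y" using se clX[OF ab(1)] y by auto
    ultimately have "(b, se a y) \<in> R"
      using ab y AB res clX[OF ab(1)] by (intro clR[of b B]) blast+
    then show ?thesis using res clX[OF ab(1)] clX[OF ab(2)] y by blast
  qed
  moreover have "A \<subseteq> ?cl A" "B \<subseteq> ?cl B" using AB by (auto simp: polar_down_def polar_up_def)
  moreover have "polar_up Y R (set_product m C D) =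
      {y \<in> Y. \<forall>c\<in>C. \<forall>d\<in>D. (m c d, y) \<in> R}" for C D
    by (auto simp: polar_up_def set_product_def)
  note this[of "?cl A" "?cl B"] this[of A B]
  ultimately have "polar_up Y R (set_product m (?cl A) (?cl B)) = polar_up Y R (set_product m A B)"
    by (elim ssubst) blast
  then show ?thesis by simp
qed

text \<open>Distributing over each supremum in turn turns the left side into a supremum of the
  products \<open>a \<star> b\<close>. It will be used with \<open>A\<close> and \<open>B\<close>
  sets of values of a sup-dense map.\<close>

lemma (in quantale) sup_qmult_sup_le_iff:
  assumes "A \<subseteq> carrier Q" "B \<subseteq> carrier Q" "c \<in> carrier Q"
  shows "\<Squnion>A \<star> \<Squnion>B \<sqsubseteq> c \<longleftrightarrow> (\<forall>a\<in>A. \<forall>b\<in>B. a \<star> b \<sqsubseteq> c)"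
proof -
  have mult: "a \<star> b \<in> carrier Q" if "a \<in> carrier Q" "b \<in> carrier Q" for a b
    using qmult_semigroup that by (simp add: semigroup_on_def)
  have "\<Squnion>A \<star> \<Squnion>B \<sqsubseteq> c \<longleftrightarrow> (\<forall>a\<in>A. a \<star> \<Squnion>B \<sqsubseteq> c)"
    using assms mult sup_closed by (subst sup_qmult) (auto simp: sup_le_iff image_subset_iff subsetD)
  also have "\<dots> \<longleftrightarrow> (\<forall>a\<in>A. \<forall>b\<in>B. a \<star> b \<sqsubseteq> c)"
  proof (rule ball_cong[OF HOL.refl])
    fix a assume "a \<in> A"
    then have "a \<in> carrier Q" using assms by auto
    then show "a \<star> \<Squnion>B \<sqsubseteq> c \<longleftrightarrow> (\<forall>b\<in>B. a \<star> b \<sqsubseteq> c)"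
      using assms mult by (subst qmult_sup) (auto simp: sup_le_iff image_subset_iff subsetD)
  qed
  finally show ?thesis .
qed

section \<open>From a representation to an isomorphism\<close>

text \<open>The inverse of \<open>h\<close> sends a closed set to the supremum of its image under
  \<open>f\<close>. Since closures are values of \<open>h\<close>, preservation of suprema and
  products reduces to equations between elements of \<open>Q\<close>, proved by comparing upper
  bounds.\<close>

lemma quantale_isomorphic_M_quantale:
  assumes "quantale Q" "semigroup_on X m" "residuated_relation X m Y R"
    and "sup_dense X Q f" and hom: "semigroup_hom_on X m (carrier Q) (qmult Q) f"
    and "inf_dense Y Q g"
    and R: "\<And>x y. x \<in> X \<Longrightarrow> y \<in> Y \<Longrightarrow> (x, y) \<in> R \<longleftrightarrow> f x \<sqsubseteq>\<^bsub>Q\<^esub> g y"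
  shows "quantale_isomorphic Q (M_quantale X m Y R)"
proof -
  interpret quantale Q by fact
  let ?M = "M_quantale X m Y R"
  interpret M: quantale ?M using assms by (intro quantale_M_quantale)
  have f: "f \<in> X \<rightarrow> carrier Q" and g: "g \<in> Y \<rightarrow> carrier Q"
    using assms(4,6) by (auto simp: sup_dense_def inf_dense_def)
  define h where "h q = {x \<in> X. f x \<sqsubseteq>\<^bsub>Q\<^esub> q}" for q
  have sep: "p \<sqsubseteq>\<^bsub>Q\<^esub> q"
    if "p \<in> carrier Q" "q \<in> carrier Q" "\<And>y. y \<in> Y \<Longrightarrow> q \<sqsubseteq>\<^bsub>Q\<^esub> g y \<Longrightarrow> p \<sqsubseteq>\<^bsub>Q\<^esub> g y" for p q
    using assms(6) that unfolding inf_dense_iff by blast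
  let ?cl = "\<lambda>A. polar_down X R (polar_up Y R A)"
  have fA: "f ` A \<subseteq> carrier Q" if "A \<subseteq> X" for A using f that by auto
  have sup_h: "\<Squnion>\<^bsub>Q\<^esub>(f ` h q) = q" if "q \<in> carrier Q" for q
  proof -
    have "f ` h q = {f x | x. x \<in> X \<and> f x \<sqsubseteq>\<^bsub>Q\<^esub> q}" by (auto simp: h_def)
    then show ?thesis using assms(4) that by (auto simp: sup_dense_def)
  qed
  \<comment> \<open>Inf-density enters here: the upper polar of \<open>A\<close> consists of the
    \<open>y\<close> with \<open>g y\<close> above the supremum, and whatever lies below all these
    \<open>g y\<close> lies below the supremum.\<close>
  have cl: "?cl A = h (\<Squnion>\<^bsub>Q\<^esub>(f ` A))" if "A \<subseteq> X" for A
  proof -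
    let ?s = "\<Squnion>\<^bsub>Q\<^esub>(f ` A)"
    have s: "?s \<in> carrier Q" using fA[OF that] by (rule sup_closed)
    have up: "polar_up Y R A = {y \<in> Y. ?s \<sqsubseteq>\<^bsub>Q\<^esub> g y}"
      using that g fA[OF that] R by (auto simp: polar_up_def sup_le_iff Pi_iff subset_iff)
    have "f x \<sqsubseteq>\<^bsub>Q\<^esub> ?s \<longleftrightarrow> (\<forall>y\<in>Y. ?s \<sqsubseteq>\<^bsub>Q\<^esub> g y \<longrightarrow> f x \<sqsubseteq>\<^bsub>Q\<^esub> g y)" if "x \<in> X" for x
    proof
      assume "f x \<sqsubseteq>\<^bsub>Q\<^esub> ?s"
      then show "\<forall>y\<in>Y. ?s \<sqsubseteq>\<^bsub>Q\<^esub> g y \<longrightarrow> f x \<sqsubseteq>\<^bsub>Q\<^esub> g y"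
        using s f g that by (blast intro: le_trans)
    next
      assume "\<forall>y\<in>Y. ?s \<sqsubseteq>\<^bsub>Q\<^esub> g y \<longrightarrow> f x \<sqsubseteq>\<^bsub>Q\<^esub> g y"
      then show "f x \<sqsubseteq>\<^bsub>Q\<^esub> ?s"
        using f s that by (intro sep[of "f x" ?s]) auto
    qed
    then show ?thesis using R by (auto simp: up polar_down_def h_def)
  qed
  have carr: "A \<in> carrier ?M \<longleftrightarrow> A \<subseteq> X \<and> ?cl A = A" for A
    unfolding M_quantale_def by auto
  have h_in: "h q \<in> carrier ?M" if "q \<in> carrier Q" for q
    using cl[of "h q"] sup_h[OF that] by (auto simp: carr h_def)
  have bij: "bij_betw h (carrier Q) (carrier ?M)"
  proof (rule bij_betw_byWitness[where f' = "\<lambda>A. \<Squnion>\<^bsub>Q\<^esub>(f ` A)"])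
    show "\<forall>A\<in>carrier ?M. h (\<Squnion>\<^bsub>Q\<^esub>(f ` A)) = A" using carr cl by metis
    show "(\<lambda>A. \<Squnion>\<^bsub>Q\<^esub>(f ` A)) ` carrier ?M \<subseteq> carrier Q"
      by (intro image_subsetI sup_closed fA) (simp only: carr)
  qed (use sup_h h_in in auto)
  have sup: "h (\<Squnion>\<^bsub>Q\<^esub>S) = \<Squnion>\<^bsub>?M\<^esub>(h ` S)" if S: "S \<subseteq> carrier Q" for S
  proof -
    have X: "\<Union>(h ` S) \<subseteq> X" by (auto simp: h_def)
    have s: "q \<sqsubseteq>\<^bsub>Q\<^esub> p \<longleftrightarrow> (\<forall>x\<in>h q. f x \<sqsubseteq>\<^bsub>Q\<^esub> p)" if "q \<in> carrier Q" "p \<in> carrier Q" for p q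
      using sup_le_iff[of "f ` h q" p] fA[of "h q"] sup_h that by (auto simp: h_def)
    have "\<Squnion>\<^bsub>Q\<^esub>S \<sqsubseteq>\<^bsub>Q\<^esub> p \<longleftrightarrow> \<Squnion>\<^bsub>Q\<^esub>(f ` \<Union>(h ` S)) \<sqsubseteq>\<^bsub>Q\<^esub> p" if p: "p \<in> carrier Q" for p
    proof -
      have "\<Squnion>\<^bsub>Q\<^esub>S \<sqsubseteq>\<^bsub>Q\<^esub> p \<longleftrightarrow> (\<forall>q\<in>S. \<forall>x\<in>h q. f x \<sqsubseteq>\<^bsub>Q\<^esub> p)"
        unfolding sup_le_iff[OF S p] using S s[OF _ p] by (meson subsetD)
      also have "\<dots> \<longleftrightarrow> \<Squnion>\<^bsub>Q\<^esub>(f ` \<Union>(h ` S)) \<sqsubseteq>\<^bsub>Q\<^esub> p"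
        unfolding sup_le_iff[OF fA[OF X] p] by simp
      finally show ?thesis .
    qed
    then have "\<Squnion>\<^bsub>Q\<^esub>S = \<Squnion>\<^bsub>Q\<^esub>(f ` \<Union>(h ` S))"
      using sup_closed[OF S] sup_closed[OF fA[OF X]] by (meson le_antisym le_refl)
    then show ?thesis
      using S h_in cl[OF X] by (subst M_quantale_sup[OF assms(2,3)]) auto
  qed
  have mult: "h (a \<star>\<^bsub>Q\<^esub> b) = h a \<star>\<^bsub>?M\<^esub> h b" if ab: "a \<in> carrier Q" "b \<in> carrier Q" for a b
  proof -
    let ?p = "set_product m (h a) (h b)"
    have X: "h a \<subseteq> X" "h b \<subseteq> X" by (auto simp: h_def)
    then have p: "?p \<subseteq> X" using assms(2) by (auto simp: semigroup_on_def set_product_def)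
    have fm: "f (m x y) = f x \<star>\<^bsub>Q\<^esub> f y" if "x \<in> h a" "y \<in> h b" for x y
      using hom X that by (simp add: semigroup_hom_on_def subset_iff)
    \<comment> \<open>Write \<open>a\<close> and \<open>b\<close> as suprema of values of
      \<open>f\<close>, distribute, and use the homomorphism property to recognize each product as a
      value of \<open>f\<close> on \<open>?p\<close>.\<close>
    have "a \<star>\<^bsub>Q\<^esub> b \<sqsubseteq>\<^bsub>Q\<^esub> c \<longleftrightarrow> \<Squnion>\<^bsub>Q\<^esub>(f ` ?p) \<sqsubseteq>\<^bsub>Q\<^esub> c" if "c \<in> carrier Q" for c
    proof -
      have "a \<star>\<^bsub>Q\<^esub> b \<sqsubseteq>\<^bsub>Q\<^esub> c \<longleftrightarrow> (\<forall>x\<in>h a. \<forall>y\<in>h b. f x \<star>\<^bsub>Q\<^esub> f y \<sqsubseteq>\<^bsub>Q\<^esub> c)"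
        using sup_qmult_sup_le_iff[OF fA[OF X(1)] fA[OF X(2)] that] sup_h ab by auto
      also have "\<dots> \<longleftrightarrow> (\<forall>z\<in>?p. f z \<sqsubseteq>\<^bsub>Q\<^esub> c)"
        using fm by (fastforce simp: set_product_def)
      finally show ?thesis using that fA[OF p] by (auto simp: sup_le_iff)
    qed
    moreover have "a \<star>\<^bsub>Q\<^esub> b \<in> carrier Q"
      using qmult_semigroup ab by (simp add: semigroup_on_def)
    ultimately have "a \<star>\<^bsub>Q\<^esub> b = \<Squnion>\<^bsub>Q\<^esub>(f ` ?p)"
      using sup_closed[OF fA[OF p]] by (meson le_antisym le_refl)
    then show ?thesis using cl[OF p] by (simp add: M_quantale_def)
  qed
  have "quantale_iso Q ?M h"
    unfolding quantale_iso_def sup_pres_def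
    using bij sup mult bij_betw_imp_funcset[OF bij] complete_lattice_axioms M.complete_lattice_axioms
    by blast
  then show ?thesis by (auto simp: quantale_isomorphic_def)
qed

section \<open>From an isomorphism to a representation\<close>

text \<open>Through \<open>h\<close>, lying above \<open>f x\<close> means containing
  \<open>x\<close>, and lying below \<open>g y\<close> means having \<open>y\<close> in the upper
  polar. Density holds because a closed set is determined by its elements and also by its upper
  polar.\<close>

lemma quantale_iso_M_quantale_represents:
  assumes "quantale Q" "semigroup_on X m" "residuated_relation X m Y R"
    and iso: "quantale_iso Q (M_quantale X m Y R) h"
  obtains f g where "sup_dense X Q f" "semigroup_hom_on X m (carrier Q) (qmult Q) f"
    "inf_dense Y Q g" "\<And>x y. x \<in> X \<Longrightarrow> y \<in> Y \<Longrightarrow> (x, y) \<in> R \<longleftrightarrow> f x \<sqsubseteq>\<^bsub>Q\<^esub> g y"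
proof -
  interpret quantale Q by fact
  let ?M = "M_quantale X m Y R"
  let ?cl = "\<lambda>A. polar_down X R (polar_up Y R A)"
  have bij: "bij_betw h (carrier Q) (carrier ?M)"
    using iso by (simp add: quantale_iso_def)
  have le: "a \<sqsubseteq>\<^bsub>Q\<^esub> b \<longleftrightarrow> h a \<subseteq> h b" if "a \<in> carrier Q" "b \<in> carrier Q" for a b
    using quantale_iso_le_iff[OF iso that] by (simp add: M_quantale_def)
  have h: "h q \<subseteq> X \<and> ?cl (h q) = h q" if "q \<in> carrier Q" for q
    using bij_betwE[OF bij] that by (auto simp: M_quantale_def)
  define k where "k = inv_into (carrier Q) h"
  have k: "k A \<in> carrier Q" "h (k A) = A" if "A \<in> carrier ?M" for A
    using bij that
    by (auto simp: k_def bij_betw_def inv_into_into f_inv_into_f)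
  define f where "f x = k (?cl {x})" for x
  define g where "g y = k (polar_down X R {y})" for y
  have cl_in: "?cl A \<in> carrier ?M" for A
    by (auto simp: M_quantale_def polar_down_def polar_up_def)
  have down_in: "polar_down X R {y} \<in> carrier ?M" if "y \<in> Y" for y
    using that by (auto simp: M_quantale_def polar_down_def polar_up_def)
  note f = k[OF cl_in, of "{_}", folded f_def]
  note g = k[OF down_in, folded g_def]
  \<comment> \<open>The closure of \<open>{x}\<close> is the least closed set containing
    \<open>x\<close>.\<close>
  have f_le: "f x \<sqsubseteq>\<^bsub>Q\<^esub> q \<longleftrightarrow> x \<in> h q" if "x \<in> X" "q \<in> carrier Q" for x q
  proof -
    have "?cl {x} \<subseteq> h q \<longleftrightarrow> x \<in> h q"
      using h[OF that(2)] that(1) unfolding polar_down_def polar_up_def by blast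
    then show ?thesis using le f that by simp
  qed
  \<comment> \<open>This is the Galois connection between the two polars, at the singleton
    \<open>{y}\<close>.\<close>
  have le_g: "q \<sqsubseteq>\<^bsub>Q\<^esub> g y \<longleftrightarrow> y \<in> polar_up Y R (h q)" if "y \<in> Y" "q \<in> carrier Q" for y q
    using le[OF that(2) g(1)] g(2) h[OF that(2)] that(1)
    by (auto simp: polar_down_def polar_up_def)
  have "sup_dense X Q f"
    unfolding sup_dense_iff
  proof (intro conjI ballI impI)
    fix p q assume pq: "p \<in> carrier Q" "q \<in> carrier Q" "\<forall>x\<in>X. f x \<sqsubseteq>\<^bsub>Q\<^esub> p \<longrightarrow> f x \<sqsubseteq>\<^bsub>Q\<^esub> q"
    then have "h p \<subseteq> h q" using f_le h[OF pq(1)] by auto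
    then show "p \<sqsubseteq>\<^bsub>Q\<^esub> q" using le pq by simp
  qed (use f in auto)
  moreover have "inf_dense Y Q g"
    unfolding inf_dense_iff
  proof (intro conjI ballI impI)
    fix p q assume pq: "p \<in> carrier Q" "q \<in> carrier Q" "\<forall>y\<in>Y. q \<sqsubseteq>\<^bsub>Q\<^esub> g y \<longrightarrow> p \<sqsubseteq>\<^bsub>Q\<^esub> g y"
    \<comment> \<open>Taking lower polars reverses this inclusion, and \<open>h p\<close> and
      \<open>h q\<close> equal their closures.\<close>
    then have "polar_up Y R (h q) \<subseteq> polar_up Y R (h p)"
      using le_g by (auto simp: polar_up_def)
    then have "?cl (h p) \<subseteq> ?cl (h q)" by (auto simp: polar_down_def)
    then show "p \<sqsubseteq>\<^bsub>Q\<^esub> q" using le h pq by simp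
  qed (use g in auto)
  moreover have "semigroup_hom_on X m (carrier Q) (qmult Q) f"
    unfolding semigroup_hom_on_def
  proof (intro conjI ballI)
    fix x y assume xy: "x \<in> X" "y \<in> X"
    \<comment> \<open>Multiplicativity is verified among closed sets and pulled back by injectivity
      of \<open>h\<close>.\<close>
    have "h (f x \<star>\<^bsub>Q\<^esub> f y) = ?cl (set_product m (?cl {x}) (?cl {y}))"
      using iso f by (simp add: quantale_iso_def M_quantale_def)
    also have "\<dots> = ?cl (set_product m {x} {y})"
      using assms xy by (intro polar_down_up_set_product) auto
    also have "\<dots> = h (f (m x y))"
      using f by (simp add: set_product_def)
    finally show "f (m x y) = f x \<star>\<^bsub>Q\<^esub> f y"
      using inj_onD[OF bij_betw_imp_inj_on[OF bij], of "f (m x y)" "f x \<star>\<^bsub>Q\<^esub> f y"]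
        f(1) qmult_semigroup by (simp add: semigroup_on_def)
  qed (use f in auto)
  \<comment> \<open>\<open>h (g y)\<close> is the lower polar of \<open>{y}\<close>, so containing
    \<open>x\<close> means that \<open>x\<close> is related to \<open>y\<close>.\<close>
  moreover have "(x, y) \<in> R \<longleftrightarrow> f x \<sqsubseteq>\<^bsub>Q\<^esub> g y" if "x \<in> X" "y \<in> Y" for x y
    using f_le g that by (simp add: polar_down_def)
  ultimately show ?thesis using that by metis
qed

section \<open>The characterization, and the order relation as an instance\<close>

theorem theorem4p4:
  fixes Q :: "'q quantale"
    and X :: "'x set" and m :: "'x \<Rightarrow> 'x \<Rightarrow> 'x"
    and Y :: "'y set" and R :: "('x \<times> 'y) set"
  assumes "quantale Q"
  shows "(semigroup_on X m \<and> residuated_relation X m Y R \<longrightarrow>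
           (quantale_isomorphic Q (M_quantale X m Y R) \<longleftrightarrow>
            (\<exists>f g. sup_dense X Q f \<and>
                   semigroup_hom_on X m (carrier Q) (qmult Q) f \<and>
                   inf_dense Y Q g \<and>
                   (\<forall>x\<in>X. \<forall>y\<in>Y. (x, y) \<in> R \<longleftrightarrow> f x \<sqsubseteq>\<^bsub>Q\<^esub> g y)))) \<and>
         quantale_isomorphic Q
           (M_quantale (carrier Q) (qmult Q) (carrier Q) (order_relation Q))"
proof (intro conjI impI iffI)
  assume XR: "semigroup_on X m \<and> residuated_relation X m Y R"
  show "\<exists>f g. sup_dense X Q f \<and> semigroup_hom_on X m (carrier Q) (qmult Q) f \<and>
      inf_dense Y Q g \<and> (\<forall>x\<in>X. \<forall>y\<in>Y. (x, y) \<in> R \<longleftrightarrow> f x \<sqsubseteq>\<^bsub>Q\<^esub> g y)"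
    if iso: "quantale_isomorphic Q (M_quantale X m Y R)"
  proof -
    obtain h where "quantale_iso Q (M_quantale X m Y R) h"
      using iso by (auto simp: quantale_isomorphic_def)
    then show ?thesis
      using quantale_iso_M_quantale_represents[OF assms conjunct1[OF XR] conjunct2[OF XR]]
      by metis
  qed
  show "quantale_isomorphic Q (M_quantale X m Y R)"
    if "\<exists>f g. sup_dense X Q f \<and> semigroup_hom_on X m (carrier Q) (qmult Q) f \<and>
      inf_dense Y Q g \<and> (\<forall>x\<in>X. \<forall>y\<in>Y. (x, y) \<in> R \<longleftrightarrow> f x \<sqsubseteq>\<^bsub>Q\<^esub> g y)"
    using that XR assms by (blast intro: quantale_isomorphic_M_quantale)
next
  interpret quantale Q by fact
  show "quantale_isomorphic Q
      (M_quantale (carrier Q) (qmult Q) (carrier Q) (order_relation Q))"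
  \<comment> \<open>The identity serves as both \<open>f\<close> and \<open>g\<close>: it represents
    the order by itself, and both separation conditions follow by reflexivity.\<close>
  proof (rule quantale_isomorphic_M_quantale)
    show "sup_dense (carrier Q) Q (\<lambda>x. x)" by (simp add: sup_dense_iff)
    show "inf_dense (carrier Q) Q (\<lambda>x. x)" by (simp add: inf_dense_iff)
    show "semigroup_hom_on (carrier Q) (qmult Q) (carrier Q) (qmult Q) (\<lambda>x. x)"
      by (simp add: semigroup_hom_on_def)
  qed (use assms qmult_semigroup residuated_order_relation in \<open>auto simp: order_relation_def\<close>)
qed

end
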